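(* Let $G$ be a Boolean extremally disconnected topological group with zero element $\mathbf{0}$ containing a countable family $\{H_n : n\in\omega\}$ of open subgroups such that $\bigcap_{n\in\omega} H_n=\{\mathbf{0}\}$. Then $G$ has an open subgroup which admits a continuous isomorphism onto a subgroup of the Cartesian product $\prod_{n\in\omega} D_n$ of countably many discrete countable Boolean groups $D_n$ with the product topology. In particular, any such group $G$ contains an open subgroup of cardinality at most $2^\omega$.
   Context: A topological space is extremally disconnected if the closure of any open set in it is open; a topological group is extremally disconnected if its underlying space is. A Boolean group is a group in which all nonidentity elements have order $2$ (such groups are Abelian and are written additively with zero element $\mathbf{0}$). "Countable" for the groups $D_n$ means at most countable. A continuous isomorphism is a group isomorphism that is continuous (its inverse is not required to be continuous); the subgroup of the product carries the subspace topology. *)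

theory Defs
  imports
    "HOL-Analysis.Analysis"
    "HOL-Algebra.Product_Groups"
    "HOL-Algebra.Multiplicative_Group"
    "HOL-Library.Equipollence"
begin

(* Groups are HOL-Algebra structures, hence written multiplicatively: the zero element of an
   additively written Boolean group is \<one>.  No separation axiom is included in the notion of a
   topological group. *)

locale topological_group = group G for G (structure) +
  fixes T :: "'a topology"
  assumes topspace_eq_carrier: "topspace T = carrier G"
    and continuous_mult: "continuous_map (prod_topology T T) T (\<lambda>(x, y). x \<otimes> y)"
    and continuous_inv: "continuous_map T T (\<lambda>x. inv x)"

locale boolean_group = group +
  assumes ord_eq_2: "\<And>x. x \<in> carrier G \<Longrightarrow> x \<noteq> \<one> \<Longrightarrow> ord x = 2"

definition extremally_disconnected_space :: "'a topology \<Rightarrow> bool" where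
  "extremally_disconnected_space T \<longleftrightarrow> (\<forall>U. openin T U \<longrightarrow> openin T (T closure_of U))"

definition open_subgroup :: "'a set \<Rightarrow> ('a, 'b) monoid_scheme \<Rightarrow> 'a topology \<Rightarrow> bool" where
  "open_subgroup H G T \<longleftrightarrow> subgroup H G \<and> openin T H"

definition continuous_iso ::
  "('a, 'm) monoid_scheme \<Rightarrow> 'a topology \<Rightarrow> ('b, 'n) monoid_scheme \<Rightarrow> 'b topology \<Rightarrow> ('a \<Rightarrow> 'b) \<Rightarrow> bool" where
  "continuous_iso G T K S f \<longleftrightarrow> f \<in> iso G K \<and> continuous_map T S f"

end

theory Submission
  imports Defs
begin

text \<open>
  Replacing the \<open>H n\<close> by a decreasing sequence \<open>K n\<close> with \<open>K 0 = G\<close>, fix a basis of each quotient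
  \<open>G/K n\<close> over the field with two elements and write \<open>\<phi> n x\<close> for the finite set of basis vectors
  occurring in the coset of \<open>x\<close>. For \<open>x \<noteq> \<one>\<close> let \<open>n\<close> be least with \<open>x \<notin> K n\<close> and colour \<open>x\<close> by the
  parity of the integer part of \<open>log 2 (card (\<phi> n x))\<close>. Both colour classes are open, so extremal
  disconnectedness gives a neighbourhood \<open>W\<close> of \<open>\<one>\<close> that is monochromatic off \<open>\<one>\<close>. Let \<open>W4\<close> be a
  neighbourhood of \<open>\<one>\<close> whose fourfold products lie in \<open>W\<close>. If \<open>\<phi> (n+1)\<close> took uncountably many
  values on \<open>W4 \<inter> K n\<close>, infinitely many of these would have the same size, hence four of them would form
  a sunflower, and the products of two and of all four of the corresponding elements would have
  supports of sizes \<open>2t\<close> and \<open>4t\<close>, which have different colours. So \<open>\<phi> n\<close> takes countably many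
  values on a small neighbourhood, and the elements whose supports use only the countably many
  basis vectors occurring there form the open subgroup.
\<close>

section \<open>Symmetric differences of finite sets; doubling and binary logarithms\<close>

text \<open>The sets chosen form a sunflower with petals of size \<open>t\<close>; combining an even
  number of them cancels the kernel. Induction on \<open>s\<close>: an element of infinitely many
  members is removed and joins the kernel; if there is none, only finitely many members meet a given
  finite set, so pairwise disjoint members can be picked one after another.\<close>

lemma sunflower4:
  fixes V :: "'a set set"
  assumes "infinite V" "\<And>X. X \<in> V \<Longrightarrow> finite X \<and> card X = s"
  shows "\<exists>A\<in>V. \<exists>B\<in>V. \<exists>C\<in>V. \<exists>D\<in>V. \<exists>t>0.
    card (sym_diff A B) = 2 * t \<and> card (sym_diff (sym_diff A B) (sym_diff C D)) = 4 * t"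
  using assms
proof (induction s arbitrary: V)
  case 0
  then have "V \<subseteq> {{}}" by (metis card_0_eq singletonI subsetI)
  then show ?case using 0(1) finite_subset by blast
next
  case (Suc s)
  show ?case
  proof (cases "\<exists>e. infinite {X\<in>V. e \<in> X}")
    case True
    then obtain e where e: "infinite {X\<in>V. e \<in> X}" by blast
    let ?V = "(\<lambda>X. X - {e}) ` {X\<in>V. e \<in> X}"
    have inj: "inj_on (\<lambda>X. X - {e}) {X\<in>V. e \<in> X}"
      by (rule inj_onI) blast
    have "infinite ?V" using e inj by (simp add: finite_image_iff)
    moreover have "finite X \<and> card X = s" if "X \<in> ?V" for X
      using that Suc.prems(2) by fastforce
    ultimately have "\<exists>A\<in>?V. \<exists>B\<in>?V. \<exists>C\<in>?V. \<exists>D\<in>?V. \<exists>t>0.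
      card (sym_diff A B) = 2 * t \<and> card (sym_diff (sym_diff A B) (sym_diff C D)) = 4 * t"
      by (rule Suc.IH)
    then obtain A B C D t where *: "A \<in> ?V" "B \<in> ?V" "C \<in> ?V" "D \<in> ?V" "t > 0"
      "card (sym_diff A B) = 2 * t" "card (sym_diff (sym_diff A B) (sym_diff C D)) = 4 * t"
      by (elim bexE exE conjE) (rule that)
    have lift: "\<exists>X'\<in>V. e \<in> X' \<and> X = X' - {e}" if "X \<in> ?V" for X using that by blast
    obtain A' where A': "A' \<in> V" "e \<in> A'" "A = A' - {e}" using lift[OF *(1)] by blast
    obtain B' where B': "B' \<in> V" "e \<in> B'" "B = B' - {e}" using lift[OF *(2)] by blast
    obtain C' where C': "C' \<in> V" "e \<in> C'" "C = C' - {e}" using lift[OF *(3)] by blast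
    obtain D' where D': "D' \<in> V" "e \<in> D'" "D = D' - {e}" using lift[OF *(4)] by blast
    have "sym_diff A' B' = sym_diff A B" "sym_diff C' D' = sym_diff C D"
      using A' B' C' D' by blast+
    then show ?thesis using *(5-)
      by (intro bexI[OF _ A'(1)] bexI[OF _ B'(1)] bexI[OF _ C'(1)] bexI[OF _ D'(1)] exI[of _ t]) simp
  next
    case False
    have avoid: "\<exists>X\<in>V. X \<inter> S = {}" if "finite S" for S
    proof (rule ccontr)
      assume "\<not> ?thesis"
      then have "V \<subseteq> (\<Union>e\<in>S. {X\<in>V. e \<in> X})" by auto
      moreover have "finite (\<Union>e\<in>S. {X\<in>V. e \<in> X})" using that False by auto
      ultimately show False using Suc.prems(1) finite_subset by blast
    qed
    have fin: "finite X" if "X \<in> V" for X using that Suc.prems(2) by blast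
    obtain A where A: "A \<in> V" using avoid[of "{}"] by auto
    obtain B where B: "B \<in> V" "B \<inter> A = {}" using avoid fin A by metis
    obtain C where C: "C \<in> V" "C \<inter> (A \<union> B) = {}" using avoid[of "A \<union> B"] fin A B by auto
    obtain D where D: "D \<in> V" "D \<inter> (A \<union> B \<union> C) = {}"
      using avoid[of "A \<union> B \<union> C"] fin A B C by auto
    have AB: "sym_diff A B = A \<union> B" and CD: "sym_diff C D = C \<union> D"
      and ABCD: "sym_diff (A \<union> B) (C \<union> D) = A \<union> B \<union> (C \<union> D)" using B C D by auto
    have "card (A \<union> B) = card A + card B" using B A fin by (intro card_Un_disjoint) auto
    moreover have "card (C \<union> D) = card C + card D" using C D fin by (intro card_Un_disjoint) auto
    moreover have "card (A \<union> B \<union> (C \<union> D)) = card (A \<union> B) + card (C \<union> D)"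
      using A B C D fin by (intro card_Un_disjoint) auto
    ultimately have "card (sym_diff A B) = 2 * Suc s"
      "card (sym_diff (sym_diff A B) (sym_diff C D)) = 4 * Suc s"
      unfolding AB CD ABCD using A B C D Suc.prems(2) by auto
    then show ?thesis
      by (intro bexI[OF _ A] bexI[OF _ B(1)] bexI[OF _ C(1)] bexI[OF _ D(1)] exI[of _ "Suc s"]) simp
  qed
qed

text \<open>Doubling a support size flips the parity used as colour, so sizes \<open>2 * t\<close>
  and \<open>4 * t\<close> are told apart.\<close>

lemma floor_log2_double:
  assumes "m > (0::nat)"
  shows "\<lfloor>log 2 (real (2 * m))\<rfloor> = \<lfloor>log 2 (real m)\<rfloor> + 1"
  using assms by (simp add: log_mult)

section \<open>Boolean groups as vector spaces over the field with two elements\<close>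

context boolean_group
begin

lemma square_eq_one:
  assumes "x \<in> carrier G"
  shows "x \<otimes> x = \<one>"
proof (cases "x = \<one>")
  case False
  then have "x [^] (2::nat) = \<one>"
    using pow_ord_eq_1[OF assms] ord_eq_2[OF assms] by simp
  then show ?thesis using assms by (simp add: numeral_2_eq_2)
qed simp

lemma inv_eq_self: "x \<in> carrier G \<Longrightarrow> inv x = x"
  using square_eq_one inv_equality by blast

lemma comm_group: "comm_group G"
proof (rule group_comm_groupI)
  fix x y assume xy: "x \<in> carrier G" "y \<in> carrier G"
  have "inv (x \<otimes> y) = inv y \<otimes> inv x" using xy by (rule inv_mult_group)
  then show "x \<otimes> y = y \<otimes> x" using xy inv_eq_self by simp
qed

end

sublocale boolean_group \<subseteq> comm_group
  by (rule comm_group)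

context boolean_group
begin

text \<open>Common elements occur twice on the right and cancel. Finite sets under symmetric
  difference thus behave like linear combinations over the field with two elements.\<close>

lemma finprod_sym_diff:
  assumes "finite A" "finite B" "A \<subseteq> carrier G" "B \<subseteq> carrier G"
  shows "finprod G (\<lambda>x. x) (sym_diff A B) = finprod G (\<lambda>x. x) A \<otimes> finprod G (\<lambda>x. x) B"
proof -
  let ?P = "finprod G (\<lambda>x. x)"
  have split: "?P X = ?P (X - Y) \<otimes> ?P (X \<inter> Y)" if "finite X" "X \<subseteq> carrier G" for X Y
  proof -
    have "?P ((X - Y) \<union> (X \<inter> Y)) = ?P (X - Y) \<otimes> ?P (X \<inter> Y)"
      using that by (intro finprod_Un_disjoint) auto
    then show ?thesis by (simp add: Un_Diff_Int)
  qed
  have cl: "?P (A - B) \<in> carrier G" "?P (B - A) \<in> carrier G" "?P (A \<inter> B) \<in> carrier G"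
    using assms by (auto intro!: finprod_closed)
  have "?P (sym_diff A B) = ?P (A - B) \<otimes> ?P (B - A)"
    using assms by (intro finprod_Un_disjoint) auto
  also have "\<dots> = (?P (A - B) \<otimes> ?P (B - A)) \<otimes> (?P (A \<inter> B) \<otimes> ?P (A \<inter> B))"
    using cl by (simp add: square_eq_one)
  also have "\<dots> = (?P (A - B) \<otimes> ?P (A \<inter> B)) \<otimes> (?P (B - A) \<otimes> ?P (A \<inter> B))"
    using cl by (simp add: m_ac)
  also have "\<dots> = ?P A \<otimes> ?P B"
    using split[of A B] split[of B A] assms by (simp add: Int_commute)
  finally show ?thesis .
qed

text \<open>Zorn's lemma yields a maximal set that is independent modulo \<open>K\<close>. As
  elements are their own inverses, \<open>x \<otimes> finprod G (\<lambda>x. x) F \<in> K\<close>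
  says that \<open>x\<close> and the product over \<open>F\<close> lie in the same coset.\<close>

lemma basis_modulo_subgroup:
  assumes K: "subgroup K G"
  shows "\<exists>E\<subseteq>carrier G. (\<forall>F. finite F \<longrightarrow> F \<subseteq> E \<longrightarrow> finprod G (\<lambda>x. x) F \<in> K \<longrightarrow> F = {}) \<and>
    (\<forall>x\<in>carrier G. \<exists>F. finite F \<and> F \<subseteq> E \<and> x \<otimes> finprod G (\<lambda>x. x) F \<in> K)"
proof -
  let ?P = "finprod G (\<lambda>x. x)"
  define indep where "indep E \<longleftrightarrow> E \<subseteq> carrier G \<and>
    (\<forall>F. finite F \<longrightarrow> F \<subseteq> E \<longrightarrow> ?P F \<in> K \<longrightarrow> F = {})" for E
  have "\<exists>M\<in>{E. indep E}. \<forall>X\<in>{E. indep E}. M \<subseteq> X \<longrightarrow> X = M"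
  proof (rule subset_Zorn_nonempty)
    show "{E. indep E} \<noteq> {}" by (auto simp: indep_def)
  next
    fix \<C> assume ne: "\<C> \<noteq> {}" and ch: "subset.chain {E. indep E} \<C>"
    have ind: "indep X" if "X \<in> \<C>" for X using ch that by (auto simp: subset.chain_def)
    have "F = {}" if F: "finite F" "F \<subseteq> \<Union>\<C>" "?P F \<in> K" for F
    proof -
      obtain X where "X \<in> \<C>" "F \<subseteq> X"
        using finite_subset_Union_chain[OF F(1,2) ne ch] by blast
      then show ?thesis using ind F by (auto simp: indep_def)
    qed
    then show "\<Union>\<C> \<in> {E. indep E}" using ind by (auto simp: indep_def)
  qed
  then obtain E where E: "indep E" and max: "\<And>X. indep X \<Longrightarrow> E \<subseteq> X \<Longrightarrow> X = E" by auto
  have Ec: "E \<subseteq> carrier G" using E by (simp add: indep_def)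
  have "\<exists>F. finite F \<and> F \<subseteq> E \<and> x \<otimes> ?P F \<in> K" if x: "x \<in> carrier G" for x
  proof (rule ccontr)
    assume no: "\<not> ?thesis"
    \<comment> \<open>A relation modulo \<open>K\<close> that involves \<open>x\<close> would
      express \<open>x\<close> through \<open>E\<close>, contrary to \<open>no\<close>; so
      \<open>insert x E\<close> is still independent.\<close>
    have "F = {}" if F: "finite F" "F \<subseteq> insert x E" "?P F \<in> K" for F
    proof (cases "x \<in> F")
      case False
      then show ?thesis using F E by (auto simp: indep_def)
    next
      case True
      have "?P (insert x (F - {x})) = x \<otimes> ?P (F - {x})"
        using F Ec x by (intro finprod_insert) auto
      then have "x \<otimes> ?P (F - {x}) \<in> K" using F True by (simp add: insert_absorb)
      moreover have "finite (F - {x})" "F - {x} \<subseteq> E" using F by auto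
      ultimately show ?thesis using no by blast
    qed
    then have "indep (insert x E)" using x Ec by (auto simp: indep_def)
    then have "x \<in> E" using max by blast
    \<comment> \<open>Once \<open>x\<close> is in \<open>E\<close>, the singleton \<open>{x}\<close>
      represents \<open>x\<close>, against \<open>no\<close>.\<close>
    moreover have "x \<otimes> ?P {x} \<in> K"
      using x square_eq_one subgroup.one_closed[OF K] by (simp add: finprod_insert)
    ultimately show False using no by (metis empty_subsetI finite.emptyI finite.insertI insert_subset)
  qed
  then show ?thesis using E by (intro exI[of _ E]) (simp add: indep_def)
qed

text \<open>\<open>\<phi> x\<close> is the set of basis elements representing \<open>x\<close>
  modulo \<open>K\<close>. By independence it is unique, and uniqueness gives additivity and the
  kernel.\<close>

lemma coordinates_modulo_subgroup:
  assumes K: "subgroup K G"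
  shows "\<exists>\<phi> :: 'a \<Rightarrow> 'a set. (\<forall>x\<in>carrier G. finite (\<phi> x)) \<and>
    (\<forall>x\<in>carrier G. \<forall>y\<in>carrier G. \<phi> (x \<otimes> y) = sym_diff (\<phi> x) (\<phi> y)) \<and>
    (\<forall>x\<in>carrier G. \<phi> x = {} \<longleftrightarrow> x \<in> K)"
proof -
  let ?P = "finprod G (\<lambda>x. x)"
  obtain E where E: "E \<subseteq> carrier G"
    and E_indep: "\<forall>F. finite F \<longrightarrow> F \<subseteq> E \<longrightarrow> ?P F \<in> K \<longrightarrow> F = {}"
    and E_span: "\<forall>x\<in>carrier G. \<exists>F. finite F \<and> F \<subseteq> E \<and> x \<otimes> ?P F \<in> K"
    using basis_modulo_subgroup[OF K] by (elim exE conjE) (rule that)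
  define \<phi> where "\<phi> x = (SOME F. finite F \<and> F \<subseteq> E \<and> x \<otimes> ?P F \<in> K)" for x
  have \<phi>: "finite (\<phi> x)" "\<phi> x \<subseteq> E" "x \<otimes> ?P (\<phi> x) \<in> K" if "x \<in> carrier G" for x
    using someI_ex[OF E_span[rule_format, OF that]] unfolding \<phi>_def by auto
  have Pc: "?P F \<in> carrier G" if "F \<subseteq> E" for F using that E by (intro finprod_closed) auto
  have uniq: "\<phi> x = F" if x: "x \<in> carrier G" and F: "finite F" "F \<subseteq> E" "x \<otimes> ?P F \<in> K" for x F
  proof -
    note c = \<phi>[OF x] Pc[OF \<phi>(2)[OF x]] Pc[OF F(2)]
    \<comment> \<open>The factor \<open>x\<close> cancels, so two representations of
      \<open>x\<close> differ by a relation among basis elements modulo \<open>K\<close>.\<close>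
    have "(x \<otimes> ?P (\<phi> x)) \<otimes> (x \<otimes> ?P F) = (x \<otimes> x) \<otimes> (?P (\<phi> x) \<otimes> ?P F)"
      using x c by (simp add: m_ac)
    also have "\<dots> = ?P (sym_diff (\<phi> x) F)"
      using finprod_sym_diff[OF c(1) F(1) subset_trans[OF c(2) E] subset_trans[OF F(2) E]] x c by (simp add: square_eq_one)
    finally have "?P (sym_diff (\<phi> x) F) \<in> K"
      using subgroup.m_closed[OF K c(3) F(3)] by simp
    then have "sym_diff (\<phi> x) F = {}" using c F by (intro E_indep[rule_format]) auto
    then show ?thesis by auto
  qed
  have add: "\<phi> (x \<otimes> y) = sym_diff (\<phi> x) (\<phi> y)" if xy: "x \<in> carrier G" "y \<in> carrier G" for x y
  proof (rule uniq)
    note c = \<phi>[OF xy(1)] \<phi>[OF xy(2)] Pc[OF \<phi>(2)[OF xy(1)]] Pc[OF \<phi>(2)[OF xy(2)]]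
    have "(x \<otimes> y) \<otimes> ?P (sym_diff (\<phi> x) (\<phi> y)) = (x \<otimes> ?P (\<phi> x)) \<otimes> (y \<otimes> ?P (\<phi> y))"
      unfolding finprod_sym_diff[OF c(1,4) subset_trans[OF c(2) E] subset_trans[OF c(5) E]]
      using c xy by (simp add: m_ac)
    then show "(x \<otimes> y) \<otimes> ?P (sym_diff (\<phi> x) (\<phi> y)) \<in> K"
      using subgroup.m_closed[OF K c(3) c(6)] by simp
  qed (use xy \<phi>[OF xy(1)] \<phi>[OF xy(2)] in auto)
  have "\<phi> x = {} \<longleftrightarrow> x \<in> K" if x: "x \<in> carrier G" for x
    using \<phi>(3)[OF x] uniq[OF x, of "{}"] x by auto
  then show ?thesis using \<phi>(1) add by (intro exI[of _ \<phi>]) simp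
qed

end

section \<open>Neighbourhoods of the identity and extremal disconnectedness\<close>

context topological_group
begin

lemma openin_carrier: "openin T (carrier G)"
  using openin_topspace[of T] topspace_eq_carrier by simp

lemma openin_left_translate:
  assumes "openin T V" "x \<in> carrier G"
  shows "openin T {y \<in> carrier G. x \<otimes> y \<in> V}"
proof -
  have "continuous_map T (prod_topology T T) (\<lambda>y. (x, y))"
    using assms(2) topspace_eq_carrier by (simp add: continuous_map_pairwise o_def)
  then have "continuous_map T T ((\<lambda>(x, y). x \<otimes> y) \<circ> (\<lambda>y. (x, y)))"
    using continuous_mult by (rule continuous_map_compose)
  then show ?thesis
    using openin_continuous_map_preimage[OF _ assms(1), of T "\<lambda>y. x \<otimes> y"] topspace_eq_carrier
    by (simp add: o_def)
qed

text \<open>Translation by \<open>x\<close> turns \<open>V\<close> into the neighbourhood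
  \<open>?N\<close> of \<open>x\<close>, so openness can be tested with neighbourhoods of
  \<one>.\<close>

lemma openin_if_left_invariant_nhds:
  assumes "A \<subseteq> carrier G"
    and "\<And>x. x \<in> A \<Longrightarrow> \<exists>V. openin T V \<and> \<one> \<in> V \<and> (\<forall>v\<in>V. x \<otimes> v \<in> A)"
  shows "openin T A"
proof (subst openin_subopen, intro ballI)
  fix x assume x: "x \<in> A"
  obtain V where V: "openin T V" "\<one> \<in> V" "\<forall>v\<in>V. x \<otimes> v \<in> A"
    using assms(2)[OF x] by (elim exE conjE) (rule that)
  have xc: "x \<in> carrier G" using x assms(1) by blast
  let ?N = "{y \<in> carrier G. inv x \<otimes> y \<in> V}"
  have "?N \<subseteq> A"
  proof
    fix y assume y: "y \<in> ?N"
    then have "x \<otimes> (inv x \<otimes> y) \<in> A" using V by blast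
    then show "y \<in> A" using y xc by (simp add: m_assoc[symmetric])
  qed
  moreover have "x \<in> ?N" using xc V by simp
  moreover have "openin T ?N" using openin_left_translate V xc by simp
  ultimately show "\<exists>N. openin T N \<and> x \<in> N \<and> N \<subseteq> A" by blast
qed

lemma nhd_one_square:
  assumes "openin T W" "\<one> \<in> W"
  shows "\<exists>V. openin T V \<and> \<one> \<in> V \<and> (\<forall>x\<in>V. \<forall>y\<in>V. x \<otimes> y \<in> W)"
proof -
  let ?M = "{p \<in> topspace (prod_topology T T). (\<lambda>(x, y). x \<otimes> y) p \<in> W}"
  have "openin (prod_topology T T) ?M"
    using continuous_mult assms(1) by (rule openin_continuous_map_preimage)
  moreover have "(\<one>, \<one>) \<in> ?M" using assms topspace_eq_carrier by simp
  ultimately obtain A B where AB: "openin T A" "openin T B" "\<one> \<in> A" "\<one> \<in> B" "A \<times> B \<subseteq> ?M"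
    unfolding openin_prod_topology_alt by meson
  have "x \<otimes> y \<in> W" if "x \<in> A \<inter> B" "y \<in> A \<inter> B" for x y
  proof -
    have "(x, y) \<in> ?M" using that AB(5) by blast
    then show ?thesis by simp
  qed
  then show ?thesis using AB by (intro exI[of _ "A \<inter> B"]) auto
qed

text \<open>The closure of the first colour class is open and misses the open second class. Hence
  either this closure or its complement is a neighbourhood of \<one> that meets only one
  class.\<close>

lemma monochromatic_nhd:
  assumes ed: "extremally_disconnected_space T"
    and A: "openin T {x \<in> carrier G. x \<noteq> \<one> \<and> c x}"
    and B: "openin T {x \<in> carrier G. x \<noteq> \<one> \<and> \<not> c x}"
  shows "\<exists>W b. openin T W \<and> \<one> \<in> W \<and> (\<forall>x\<in>W. x \<noteq> \<one> \<longrightarrow> c x = b)"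
proof -
  let ?A = "{x \<in> carrier G. x \<noteq> \<one> \<and> c x}" and ?B = "{x \<in> carrier G. x \<noteq> \<one> \<and> \<not> c x}"
  let ?C = "T closure_of ?A"
  have o: "openin T ?C" using ed A by (simp add: extremally_disconnected_space_def)
  have sub: "?A \<subseteq> ?C" using closure_of_subset[of ?A T] topspace_eq_carrier by auto
  have C: "?C \<subseteq> carrier G" using closure_of_subset_topspace[of T ?A] topspace_eq_carrier by simp
  have "?B \<inter> ?C = {}" using B by (simp add: openin_Int_closure_of_eq_empty) auto
  show ?thesis
  proof (cases "\<one> \<in> ?C")
    case True
    have "\<forall>x\<in>?C. x \<noteq> \<one> \<longrightarrow> c x = True" using \<open>?B \<inter> ?C = {}\<close> C by blast
    then show ?thesis using o True by blast
  next
    case False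
    have "openin T (carrier G - ?C)" using openin_carrier by (simp add: openin_diff)
    moreover have "\<forall>x\<in>carrier G - ?C. x \<noteq> \<one> \<longrightarrow> c x = False" using sub by blast
    ultimately show ?thesis using False by blast
  qed
qed

end

section \<open>An open subgroup with countably many basis vectors at each level\<close>

text \<open>A countable set has only countably many finite subsets, so each \<open>\<phi> n\<close>
  is a homomorphism from \<open>U\<close> to a countable Boolean group, with kernel
  \<open>U \<inter> K n\<close>.\<close>

lemma open_subgroup_countable_coordinates:
  fixes G :: "('a, 'b) monoid_scheme" (structure) and T :: "'a topology" and K :: "nat \<Rightarrow> 'a set"
  assumes top: "topological_group G T" and bool: "boolean_group G"
    and ed: "extremally_disconnected_space T"
    and K_open: "\<And>n. open_subgroup (K n) G T"
    and K_0: "K 0 = carrier G" and anti: "antimono K" and K_Inter: "(\<Inter>n. K n) = {\<one>}"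
  shows "\<exists>U (\<phi> :: nat \<Rightarrow> 'a \<Rightarrow> 'a set). open_subgroup U G T \<and>
    (\<forall>n. countable (\<Union>x\<in>U. \<phi> n x)) \<and>
    (\<forall>n. \<forall>x\<in>U. finite (\<phi> n x)) \<and>
    (\<forall>n. \<forall>x\<in>U. \<forall>y\<in>U. \<phi> n (x \<otimes> y) = sym_diff (\<phi> n x) (\<phi> n y)) \<and>
    (\<forall>n. \<forall>x\<in>U. \<phi> n x = {} \<longleftrightarrow> x \<in> K n)"
proof -
  interpret topological_group G T by (rule top)
  interpret boolean_group G by (rule bool)
  have K_sub: "subgroup (K n) G" and K_op: "openin T (K n)" for n
    using K_open by (auto simp: open_subgroup_def)
  have K_carrier: "x \<in> carrier G" if "x \<in> K n" for x n using subgroup.mem_carrier[OF K_sub that] .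
  have K_mono: "x \<in> K m" if "x \<in> K n" "m \<le> n" for x m n using antimonoD[OF anti that(2)] that(1) by blast
  have "\<forall>n. \<exists>\<phi> :: 'a \<Rightarrow> 'a set. (\<forall>x\<in>carrier G. finite (\<phi> x)) \<and>
    (\<forall>x\<in>carrier G. \<forall>y\<in>carrier G. \<phi> (x \<otimes> y) = sym_diff (\<phi> x) (\<phi> y)) \<and>
    (\<forall>x\<in>carrier G. \<phi> x = {} \<longleftrightarrow> x \<in> K n)"
    by (intro allI coordinates_modulo_subgroup K_sub)
  from choice[OF this] obtain \<phi> :: "nat \<Rightarrow> 'a \<Rightarrow> 'a set"
    where \<phi>: "\<forall>n. (\<forall>x\<in>carrier G. finite (\<phi> n x)) \<and>
      (\<forall>x\<in>carrier G. \<forall>y\<in>carrier G. \<phi> n (x \<otimes> y) = sym_diff (\<phi> n x) (\<phi> n y)) \<and>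
      (\<forall>x\<in>carrier G. \<phi> n x = {} \<longleftrightarrow> x \<in> K n)"
    by (elim exE) (rule that)
  have \<phi>_fin: "finite (\<phi> n x)" if "x \<in> carrier G" for n x
    using \<phi> that by simp
  have \<phi>_mult: "\<phi> n (x \<otimes> y) = sym_diff (\<phi> n x) (\<phi> n y)" if "x \<in> carrier G" "y \<in> carrier G" for n x y
    using \<phi> that by simp
  have \<phi>_ker: "\<phi> n x = {} \<longleftrightarrow> x \<in> K n" if "x \<in> carrier G" for n x
    using \<phi> that by simp
  \<comment> \<open>For \<open>x \<noteq> \<one>\<close> the level exists because the
    \<open>K n\<close> meet in \<one>, and it is a successor because \<open>K 0\<close> is the whole
    group.\<close>
  define lev where "lev x = (LEAST m. x \<notin> K m)" for x
  have lev_eq: "lev x = Suc n" if "x \<in> K n" "x \<notin> K (Suc n)" for x n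
    unfolding lev_def
  proof (rule Least_equality)
    fix m assume "x \<notin> K m"
    then have "\<not> m \<le> n" using that(1) K_mono by blast
    then show "Suc n \<le> m" by simp
  qed (rule that)
  define c where "c x \<longleftrightarrow> even \<lfloor>log 2 (real (card (\<phi> (lev x) x)))\<rfloor>" for x
  \<comment> \<open>Multiplying by an element of \<open>K (lev x)\<close> changes neither the level
    of \<open>x\<close> nor its coordinates at that level.\<close>
  have c_locally_constant: "x \<otimes> v \<noteq> \<one> \<and> c (x \<otimes> v) = c x"
    if x: "x \<in> carrier G" "x \<noteq> \<one>" and v: "v \<in> K (lev x)" for x v
  proof -
    obtain m where "x \<notin> K m" using x K_Inter by blast
    then have notin: "x \<notin> K (lev x)" unfolding lev_def by (rule LeastI)
    then obtain n where n: "lev x = Suc n" using x K_0 by (cases "lev x") auto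
    have "x \<in> K n" using not_less_Least[of n "\<lambda>m. x \<notin> K m"] n unfolding lev_def by simp
    moreover have "v \<in> K n" using K_mono v n by simp
    ultimately have xv: "x \<otimes> v \<in> K n" by (rule subgroup.m_closed[OF K_sub])
    have vc: "v \<in> carrier G" using v K_carrier by blast
    have \<phi>: "\<phi> (Suc n) (x \<otimes> v) = \<phi> (Suc n) x"
      using \<phi>_mult[OF x(1) vc] \<phi>_ker[OF vc, of "Suc n"] v n by simp
    have xv': "x \<otimes> v \<notin> K (Suc n)"
      using \<phi> \<phi>_ker[of "x \<otimes> v" "Suc n"] \<phi>_ker[OF x(1), of "Suc n"] notin n x vc by simp
    then have "x \<otimes> v \<noteq> \<one>" using subgroup.one_closed[OF K_sub] by metis
    then show ?thesis using lev_eq[OF xv xv'] \<phi> n by (simp add: c_def)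
  qed
  have c_open: "openin T {x \<in> carrier G. x \<noteq> \<one> \<and> c x = b}" for b
  proof (rule openin_if_left_invariant_nhds)
    fix x assume x: "x \<in> {x \<in> carrier G. x \<noteq> \<one> \<and> c x = b}"
    then have "\<forall>v\<in>K (lev x). x \<otimes> v \<in> {x \<in> carrier G. x \<noteq> \<one> \<and> c x = b}"
      using c_locally_constant K_carrier by auto
    then show "\<exists>V. openin T V \<and> \<one> \<in> V \<and> (\<forall>v\<in>V. x \<otimes> v \<in> {x \<in> carrier G. x \<noteq> \<one> \<and> c x = b})"
      using K_op subgroup.one_closed[OF K_sub] by blast
  qed auto
  obtain W b where W: "openin T W" "\<one> \<in> W" and mono: "\<And>x. x \<in> W \<Longrightarrow> x \<noteq> \<one> \<Longrightarrow> c x = b"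
    using monochromatic_nhd[OF ed, of c] c_open[of True] c_open[of False] by auto
  obtain W2 where W2: "openin T W2" "\<one> \<in> W2" "\<forall>x\<in>W2. \<forall>y\<in>W2. x \<otimes> y \<in> W"
    using nhd_one_square[OF W] by (elim exE conjE) (rule that)
  obtain W4 where W4: "openin T W4" "\<one> \<in> W4" "\<forall>x\<in>W4. \<forall>y\<in>W4. x \<otimes> y \<in> W2"
    using nhd_one_square[OF W2(1,2)] by (elim exE conjE) (rule that)
  \<comment> \<open>One more shrinking: products of two elements of \<open>N\<close> lie in
    \<open>W4\<close>, which allows fibres over \<open>N\<close> to be translated into
    \<open>W4\<close> below.\<close>
  obtain N where N: "openin T N" "\<one> \<in> N" "\<forall>x\<in>N. \<forall>y\<in>N. x \<otimes> y \<in> W4"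
    using nhd_one_square[OF W4(1,2)] by (elim exE conjE) (rule that)
  have N_carrier: "N \<subseteq> carrier G" using N(1) openin_subset topspace_eq_carrier by blast
  have countable_layer: "countable (\<phi> (Suc n) ` (W4 \<inter> K n))" for n
  proof -
    let ?V = "\<phi> (Suc n) ` (W4 \<inter> K n)"
    \<comment> \<open>Only finitely many supports of each size occur, which makes \<open>?V\<close>
      a countable union of finite sets.\<close>
    have "finite {X \<in> ?V. card X = s}" for s
    proof (rule ccontr)
      let ?Vs = "{X \<in> ?V. card X = s}"
      assume "infinite ?Vs"
      moreover have "finite X \<and> card X = s" if "X \<in> ?Vs" for X
        using that \<phi>_fin K_carrier by auto
      ultimately have "\<exists>A\<in>?Vs. \<exists>B\<in>?Vs. \<exists>C\<in>?Vs. \<exists>D\<in>?Vs. \<exists>t>0.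
        card (sym_diff A B) = 2 * t \<and> card (sym_diff (sym_diff A B) (sym_diff C D)) = 4 * t"
        by (rule sunflower4)
      then obtain A B C D t where ABCD: "A \<in> ?Vs" "B \<in> ?Vs" "C \<in> ?Vs" "D \<in> ?Vs"
        and t: "t > 0" "card (sym_diff A B) = 2 * t"
          "card (sym_diff (sym_diff A B) (sym_diff C D)) = 4 * t"
        by (elim bexE exE conjE) (rule that)
      have lift: "\<exists>x. x \<in> W4 \<and> x \<in> K n \<and> X = \<phi> (Suc n) x" if "X \<in> ?Vs" for X using that by blast
      obtain x where x: "x \<in> W4" "x \<in> K n" "A = \<phi> (Suc n) x" using lift[OF ABCD(1)] by blast
      obtain y where y: "y \<in> W4" "y \<in> K n" "B = \<phi> (Suc n) y" using lift[OF ABCD(2)] by blast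
      obtain z where z: "z \<in> W4" "z \<in> K n" "C = \<phi> (Suc n) z" using lift[OF ABCD(3)] by blast
      obtain w where w: "w \<in> W4" "w \<in> K n" "D = \<phi> (Suc n) w" using lift[OF ABCD(4)] by blast
      note e = x y z w
      \<comment> \<open>An element of \<open>K n\<close> with nonempty support modulo
        \<open>K (Suc n)\<close> has level \<open>Suc n\<close>, so its colour is read off from the
        size of that support.\<close>
      have c: "c u \<longleftrightarrow> even \<lfloor>log 2 (real m)\<rfloor>" "u \<noteq> \<one>"
        if u: "u \<in> K n" "card (\<phi> (Suc n) u) = m" "m > 0" for u m
      proof -
        have "u \<notin> K (Suc n)" using u \<phi>_ker[OF K_carrier[OF u(1)], of "Suc n"] by auto
        then show "c u \<longleftrightarrow> even \<lfloor>log 2 (real m)\<rfloor>" "u \<noteq> \<one>"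
          using lev_eq[OF u(1)] u(2) subgroup.one_closed[OF K_sub] by (auto simp: c_def)
      qed
      note cl = e(2,5,8,11)[THEN K_carrier]
      have xy: "x \<otimes> y \<in> K n" and zw: "z \<otimes> w \<in> K n" using e subgroup.m_closed[OF K_sub] by auto
      then have xyzw: "x \<otimes> y \<otimes> (z \<otimes> w) \<in> K n" by (rule subgroup.m_closed[OF K_sub])
      \<comment> \<open>Padding with \<open>\<one> \<in> W2\<close> brings the product of only two
        elements into \<open>W\<close> as well.\<close>
      have "x \<otimes> y \<otimes> \<one> \<in> W" "x \<otimes> y \<otimes> (z \<otimes> w) \<in> W" using e W2 W4 by auto
      then have in_W: "x \<otimes> y \<in> W" "x \<otimes> y \<otimes> (z \<otimes> w) \<in> W" using cl by auto
      have "card (\<phi> (Suc n) (x \<otimes> y)) = 2 * t" using t cl e \<phi>_mult by simp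
      note c1 = c[OF xy this] mono[OF in_W(1)]
      have "card (\<phi> (Suc n) (x \<otimes> y \<otimes> (z \<otimes> w))) = 2 * (2 * t)" using t cl e \<phi>_mult by simp
      note c2 = c[OF xyzw this] mono[OF in_W(2)]
      \<comment> \<open>Both products lie in \<open>W\<close> off \<one> and so share the colour
        \<open>b\<close>, although their support sizes differ by a factor of two.\<close>
      have "even \<lfloor>log 2 (real (2 * t))\<rfloor> = even \<lfloor>log 2 (real (2 * (2 * t)))\<rfloor>"
        using c1 c2 t(1) by simp
      then show False using floor_log2_double[of "2 * t"] t(1) by simp
    qed
    then have "countable (\<Union>s. {X \<in> ?V. card X = s})"
      by (intro countable_UN) (auto intro: countable_finite)
    then show ?thesis by (rule countable_subset[rotated]) auto
  qed
  \<comment> \<open>Induction on the level: there are countably many fibres of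
    \<open>\<phi> n\<close> on \<open>N\<close>, and on each of them \<open>\<phi> (Suc n)\<close>
    takes countably many values.\<close>
  have countable_N: "countable (\<phi> n ` N)" for n
  proof (induction n)
    case 0
    have "\<phi> 0 ` N \<subseteq> {{}}" using N_carrier \<phi>_ker[of _ 0] K_0 by auto
    then show ?case using countable_finite finite_subset by blast
  next
    case (Suc n)
    have fibre: "countable (\<phi> (Suc n) ` {x \<in> N. \<phi> n x = X})" for X
    proof (cases "\<exists>y\<in>N. \<phi> n y = X")
      case True
      then obtain y where y: "y \<in> N" "\<phi> n y = X" by blast
      then have yc: "y \<in> carrier G" using N_carrier by blast
      \<comment> \<open>Multiplication by the fixed \<open>y\<close> moves the fibre into
        \<open>W4 \<inter> K n\<close>; taking the symmetric difference with the support of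
        \<open>y\<close> undoes this.\<close>
      have "\<phi> (Suc n) ` {x \<in> N. \<phi> n x = X} \<subseteq> (\<lambda>Z. sym_diff (\<phi> (Suc n) y) Z) ` \<phi> (Suc n) ` (W4 \<inter> K n)"
      proof (safe)
        fix x assume x: "x \<in> N" "X = \<phi> n x"
        then have xc: "x \<in> carrier G" using N_carrier by blast
        have "\<phi> n (y \<otimes> x) = {}" using \<phi>_mult[OF yc xc] x y by simp
        then have "y \<otimes> x \<in> W4 \<inter> K n" using \<phi>_ker[of "y \<otimes> x" n] xc yc N(3) x y by simp
        moreover have "\<phi> (Suc n) x = sym_diff (\<phi> (Suc n) y) (\<phi> (Suc n) (y \<otimes> x))"
          using \<phi>_mult[OF yc xc] by auto
        ultimately show "\<phi> (Suc n) x \<in> (\<lambda>Z. sym_diff (\<phi> (Suc n) y) Z) ` \<phi> (Suc n) ` (W4 \<inter> K n)"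
          by blast
      qed
      then show ?thesis by (rule countable_subset[OF _ countable_image[OF countable_layer]])
    next
      case False
      then have "{x \<in> N. \<phi> n x = X} = {}" by blast
      then show ?thesis by (metis countable_empty image_empty)
    qed
    have "\<phi> (Suc n) ` N = (\<Union>X\<in>\<phi> n ` N. \<phi> (Suc n) ` {x \<in> N. \<phi> n x = X})" by blast
    moreover have "countable \<dots>" using Suc fibre by (intro countable_UN)
    ultimately show ?case by simp
  qed
  define C where "C n = (\<Union>x\<in>N. \<phi> n x)" for n
  have C: "countable (C n)" for n
  proof -
    have "countable (\<Union>X\<in>\<phi> n ` N. X)"
      using countable_N \<phi>_fin[OF subsetD[OF N_carrier]]
      by (intro countable_UN) (auto intro: countable_finite)
    then show ?thesis by (simp add: C_def)
  qed
  \<comment> \<open>Symmetric differences stay inside \<open>C n\<close>, so \<open>U\<close> is a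
    subgroup; it is open because it contains \<open>N\<close>.\<close>
  define U where "U = {x \<in> carrier G. \<forall>n. \<phi> n x \<subseteq> C n}"
  have N_U: "N \<subseteq> U" using N_carrier by (auto simp: U_def C_def)
  have mult_U: "x \<otimes> y \<in> U" if "x \<in> U" "y \<in> U" for x y
    using that \<phi>_mult[of x y] unfolding U_def by blast
  have "subgroup U G"
    by (rule subgroupI) (use N_U N(2) mult_U inv_eq_self in \<open>auto simp: U_def\<close>)
  moreover have "openin T U"
  proof (rule openin_if_left_invariant_nhds)
    fix x assume "x \<in> U"
    then have "\<forall>v\<in>N. x \<otimes> v \<in> U" using mult_U N_U by blast
    then show "\<exists>V. openin T V \<and> \<one> \<in> V \<and> (\<forall>v\<in>V. x \<otimes> v \<in> U)" using N(1,2) by blast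
  qed (auto simp: U_def)
  ultimately have "open_subgroup U G T" by (simp add: open_subgroup_def)
  moreover have "countable (\<Union>x\<in>U. \<phi> n x)" for n
    by (rule countable_subset[OF _ C[of n]]) (auto simp: U_def)
  moreover have "x \<in> carrier G" if "x \<in> U" for x using that by (simp add: U_def)
  ultimately show ?thesis
    using \<phi>_fin \<phi>_mult \<phi>_ker by (intro exI[of _ U] exI[of _ \<phi>]) simp
qed

section \<open>Embedding into a product of countable discrete groups\<close>

text \<open>The finite sets of naturals under symmetric difference, coded as naturals by
  \<open>set_encode\<close>: a direct sum of countably many groups of order two.\<close>

definition finite_set_group :: "nat monoid" where
  "finite_set_group = \<lparr>carrier = UNIV,
    monoid.mult = (\<lambda>a b. set_encode (sym_diff (set_decode a) (set_decode b))), one = 0\<rparr>"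

lemma boolean_group_finite_set_group: "boolean_group finite_set_group"
proof -
  have assoc: "sym_diff (sym_diff A B) C = sym_diff A (sym_diff B C)" for A B C :: "nat set" by blast
  interpret group finite_set_group
  proof (rule groupI)
    fix x assume "x \<in> carrier finite_set_group"
    then show "\<exists>y\<in>carrier finite_set_group. y \<otimes>\<^bsub>finite_set_group\<^esub> x = \<one>\<^bsub>finite_set_group\<^esub>"
      by (intro bexI[of _ x]) (simp_all add: finite_set_group_def)
  qed (simp_all add: finite_set_group_def assoc)
  show ?thesis
  proof
    fix x assume x: "x \<in> carrier finite_set_group" "x \<noteq> \<one>\<^bsub>finite_set_group\<^esub>"
    have "x [^]\<^bsub>finite_set_group\<^esub> (2::nat) = \<one>\<^bsub>finite_set_group\<^esub>"
      using x by (simp add: numeral_2_eq_2) (simp add: finite_set_group_def)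
    then have "ord x dvd 2" using pow_eq_id x by blast
    moreover have "ord x \<noteq> 1" using x ord_eq_1 by blast
    ultimately show "ord x = 2" using prime_nat_iff two_is_prime_nat by blast
  qed
qed

(* The groups D n are taken with carriers inside nat; every countable group has an isomorphic
   copy of this form. *)
theorem mainTheorem1:
  fixes G :: "('a, 'b) monoid_scheme" and T :: "'a topology" and H :: "nat \<Rightarrow> 'a set"
  assumes "topological_group G T"
    and "boolean_group G"
    and "extremally_disconnected_space T"
    and "\<And>n. open_subgroup (H n) G T"
    and "(\<Inter>n. H n) = {\<one>\<^bsub>G\<^esub>}"
  shows "(\<exists>U (D :: nat \<Rightarrow> nat monoid) S f.
            open_subgroup U G T \<and>
            (\<forall>n. boolean_group (D n) \<and> countable (carrier (D n))) \<and>
            subgroup S (product_group UNIV D) \<and>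
            continuous_iso
              (G\<lparr>carrier := U\<rparr>) (subtopology T U)
              ((product_group UNIV D)\<lparr>carrier := S\<rparr>)
              (subtopology (product_topology (\<lambda>n. discrete_topology (carrier (D n))) UNIV) S)
              f) \<and>
         (\<exists>U. open_subgroup U G T \<and> U \<lesssim> (UNIV :: nat set set))"
proof -
  interpret topological_group G T by (rule assms(1))
  interpret boolean_group G by (rule assms(2))
  have H: "subgroup (H n) G" "openin T (H n)" for n using assms(4) by (auto simp: open_subgroup_def)
  \<comment> \<open>The strict bound makes \<open>K 0\<close> the whole group, as the definition of
    levels requires.\<close>
  define K where "K n = carrier G \<inter> (\<Inter>i<n. H i)" for n
  have K_Suc: "K (Suc n) = K n \<inter> H n" for n by (auto simp: K_def lessThan_Suc)
  have K_0: "K 0 = carrier G" by (simp add: K_def)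
  have "subgroup (K n) G \<and> openin T (K n)" for n
  proof (induction n)
    case 0
    show ?case using subgroup_self openin_carrier by (simp add: K_0)
  next
    case (Suc n)
    then show ?case using H[of n] by (simp add: K_Suc subgroups_Inter_pair openin_Int)
  qed
  then have K_open: "open_subgroup (K n) G T" for n by (simp add: open_subgroup_def)
  have anti: "antimono K" by (rule antimonoI) (auto simp: K_def)
  have "(\<Inter>n. K n) = carrier G \<inter> (\<Inter>n. H n)" by (auto simp: K_def)
  then have K_Inter: "(\<Inter>n. K n) = {\<one>\<^bsub>G\<^esub>}" using assms(5) by simp
  obtain U and \<phi> :: "nat \<Rightarrow> 'a \<Rightarrow> 'a set" where U: "open_subgroup U G T"
    and C: "\<forall>n. countable (\<Union>x\<in>U. \<phi> n x)"
    and \<phi>_fin: "\<forall>n. \<forall>x\<in>U. finite (\<phi> n x)"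
    and \<phi>_mult: "\<forall>n. \<forall>x\<in>U. \<forall>y\<in>U. \<phi> n (x \<otimes>\<^bsub>G\<^esub> y) = sym_diff (\<phi> n x) (\<phi> n y)"
    and \<phi>_ker: "\<forall>n. \<forall>x\<in>U. \<phi> n x = {} \<longleftrightarrow> x \<in> K n"
    using open_subgroup_countable_coordinates[OF assms(1-3) K_open K_0 anti K_Inter]
    by (elim exE conjE) (rule that)
  have U_sub: "subgroup U G" and U_op: "openin T U" using U by (auto simp: open_subgroup_def)
  \<comment> \<open>The same group serves as every factor: any countable set of basis vectors can be
    numbered by naturals.\<close>
  let ?D = "\<lambda>n::nat. finite_set_group"
  let ?P = "product_group UNIV ?D"
  define g where "g n = to_nat_on (\<Union>x\<in>U. \<phi> n x)" for n
  have g_inj: "inj_on (g n) (\<Union>x\<in>U. \<phi> n x)" for n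
    unfolding g_def by (rule inj_on_to_nat_on[OF C[rule_format]])
  define f where "f x n = set_encode (g n ` \<phi> n x)" for x n
  \<comment> \<open>Injectivity of \<open>g n\<close> on the basis vectors in use lets images
    commute with set difference.\<close>
  have f_mult: "f (x \<otimes>\<^bsub>G\<^esub> y) n = f x n \<otimes>\<^bsub>finite_set_group\<^esub> f y n" if xy: "x \<in> U" "y \<in> U" for x y n
  proof -
    have diff: "g n ` (\<phi> n x - \<phi> n y) = g n ` \<phi> n x - g n ` \<phi> n y" if "x \<in> U" "y \<in> U" for x y
      using that by (intro inj_on_image_set_diff[OF g_inj]) auto
    have "g n ` sym_diff (\<phi> n x) (\<phi> n y) = sym_diff (g n ` \<phi> n x) (g n ` \<phi> n y)"
      unfolding image_Un diff[OF xy] diff[OF xy(2,1)] ..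
    then show ?thesis using xy \<phi>_mult \<phi>_fin by (simp add: f_def finite_set_group_def)
  qed
  have f_eq_0: "f x n = 0 \<longleftrightarrow> x \<in> K n" if "x \<in> U" for x n
  proof -
    have "f x n = set_encode {} \<longleftrightarrow> g n ` \<phi> n x = {}"
      unfolding f_def using \<phi>_fin that by (intro set_encode_eq) auto
    then show ?thesis using \<phi>_ker that by simp
  qed
  interpret P: group ?P
    using boolean_group_finite_set_group boolean_group.axioms(1) by (intro product_group) blast
  let ?U = "G\<lparr>carrier := U\<rparr>"
  have U_group: "group ?U" by (rule subgroup_imp_group[OF U_sub])
  have hom: "f \<in> hom ?U ?P"
    using f_mult by (intro homI) (auto simp: product_group_def finite_set_group_def)
  interpret f: group_hom ?U ?P f
    using U_group P.group_axioms hom by (simp add: group_hom_def group_hom_axioms_def)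
  have one_P: "\<one>\<^bsub>?P\<^esub> = (\<lambda>n. 0)" by (simp add: finite_set_group_def restrict_def)
  \<comment> \<open>The kernel of \<open>f\<close> lies in every \<open>K n\<close>, hence is
    trivial.\<close>
  have f_inj: "inj_on f U"
  proof -
    have "x = \<one>\<^bsub>G\<^esub>" if x: "x \<in> U" "f x = (\<lambda>n. 0)" for x
    proof -
      have "x \<in> K n" for n using f_eq_0[OF x(1), of n] x(2) by simp
      then show ?thesis using K_Inter by blast
    qed
    then have "inj_on f (carrier ?U)"
      unfolding f.inj_on_one_iff one_P by simp
    then show ?thesis by simp
  qed
  have img: "subgroup (f ` U) ?P" using f.img_is_subgroup by simp
  have iso: "f \<in> iso ?U (?P\<lparr>carrier := f ` U\<rparr>)"
    using hom f_inj by (auto simp: iso_def hom_def bij_betw_def)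
  \<comment> \<open>Each component is constant on the cosets of the open subgroup
    \<open>U \<inter> K n\<close>, so preimages of arbitrary sets are open.\<close>
  have "continuous_map (subtopology T U) (discrete_topology UNIV) (\<lambda>x. f x n)" for n
    unfolding continuous_map_def
  proof (intro conjI allI impI)
    fix B :: "nat set"
    have top_U: "topspace (subtopology T U) = U"
      using U_op openin_subset by (auto simp: topspace_subtopology)
    let ?A = "{x \<in> U. f x n \<in> B}"
    have "openin T ?A"
    proof (rule openin_if_left_invariant_nhds)
      show "?A \<subseteq> carrier G" using subgroup.subset[OF U_sub] by blast
    next
      fix x assume x: "x \<in> ?A"
      have "x \<otimes>\<^bsub>G\<^esub> v \<in> ?A" if v: "v \<in> U \<inter> K n" for v
        using x v f_mult[of x v n] f_eq_0[of v n] subgroup.m_closed[OF U_sub, of x v]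
        by (simp add: finite_set_group_def)
      moreover have "openin T (U \<inter> K n)" "\<one>\<^bsub>G\<^esub> \<in> U \<inter> K n"
        using U_op U_sub K_open[of n] by (auto simp: open_subgroup_def subgroup.one_closed)
      ultimately show "\<exists>V. openin T V \<and> \<one>\<^bsub>G\<^esub> \<in> V \<and> (\<forall>v\<in>V. x \<otimes>\<^bsub>G\<^esub> v \<in> ?A)" by blast
    qed
    then have "openin (subtopology T U) ?A" by (auto simp: openin_open_subtopology[OF U_op])
    then show "openin (subtopology T U) {x \<in> topspace (subtopology T U). f x n \<in> B}"
      unfolding top_U .
  qed simp
  then have cont: "continuous_map (subtopology T U)
      (subtopology (product_topology (\<lambda>n. discrete_topology (carrier (?D n))) UNIV) (f ` U)) f"
    by (auto simp: continuous_map_in_subtopology continuous_map_componentwise_UNIV finite_set_group_def)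
  have "open_subgroup U G T \<and>
      (\<forall>n. boolean_group (?D n) \<and> countable (carrier (?D n))) \<and> subgroup (f ` U) ?P \<and>
      continuous_iso ?U (subtopology T U) (?P\<lparr>carrier := f ` U\<rparr>)
        (subtopology (product_topology (\<lambda>n. discrete_topology (carrier (?D n))) UNIV) (f ` U)) f"
    using U boolean_group_finite_set_group img iso cont by (simp add: continuous_iso_def)
  moreover have "U \<lesssim> (UNIV :: nat set set)"
  proof -
    \<comment> \<open>The graph of the sequence \<open>f x\<close>, coded as a set of naturals; it
      determines \<open>f x\<close> and hence \<open>x\<close>.\<close>
    define h where "h x = {prod_encode (n, f x n) | n. True}" for x
    have "inj_on h U"
    proof (rule inj_onI)
      fix x y assume xy: "x \<in> U" "y \<in> U" "h x = h y"
      have "f x n = f y n" for n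
      proof -
        have "prod_encode (n, f x n) \<in> h y" unfolding xy(3)[symmetric] by (auto simp: h_def)
        then show ?thesis by (auto simp: h_def)
      qed
      then show "x = y" using f_inj xy(1,2) by (auto dest: inj_onD)
    qed
    then show ?thesis unfolding lepoll_def by blast
  qed
  ultimately show ?thesis
    using U by (intro conjI exI[of _ U] exI[of _ ?D] exI[of _ "f ` U"] exI[of _ f]) simp_all
qed

end
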